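(* Let $K\ge 2$ and consider the $K$-user deterministic interference channel in which, for each prime $q$, receiver $i\in\{1,\dots,K\}$ observes $$Y_i=X_i\Big(\sum_{j\in\{1,\dots,K\},\ j\neq i}X_j\Big)\in\mathbb{Z}_q .$$ Then the total degrees of freedom of this channel is $\mathrm{DoF}=\frac{K}{2}$.
   Context: $\mathbb{Z}_q$ denotes the integers modulo a prime $q$. There are $K$ transmitter/receiver pairs (users); in each time slot transmitter $i$ sends $X_i\in\mathbb{Z}_q$, and receiver $i$ observes $Y_i$, computed modulo $q$. The channel is memoryless (the same map is applied in each time slot). Codes and rates: for a block length $l\ge1$, user $i$ has a codebook $\mathcal{C}_i\subset\mathbb{Z}_q^l$; transmitter $i$ sends a codeword of $\mathcal{C}_i$ over $l$ time slots, and its rate is $R_i=\frac1l\log|\mathcal{C}_i|$. The rate tuple $(R_1,\dots,R_K)$ is achievable (for the given $q$) if there are such $l$ and codebooks for which each receiver $i$ can determine the codeword sent by transmitter $i$ from its $l$ received symbols, for every choice of codewords of all users. Total degrees of freedom: $$\mathrm{DoF}=\limsup_{q\to\infty,\ q\text{ prime}}\ \frac{\sup\{\sum_{i=1}^K R_i:(R_1,\dots,R_K)\text{ achievable}\}}{\log q}.$$ *)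

theory Defs
  imports "HOL-Library.Extended_Real" "HOL-Library.Liminf_Limsup" "HOL-Library.FuncSet"
    "HOL-Computational_Algebra.Primes"
begin

text \<open>
  Elements of \<open>\<int>/q\<int>\<close> are represented by their residues in \<open>{0..<q}\<close>, users are indexed by
  \<open>{1..K}\<close> and the time slots of a block by \<open>{..<l}\<close>.
\<close>

definition words :: "nat \<Rightarrow> nat \<Rightarrow> (nat \<Rightarrow> int) set" where
  "words q l = {..<l} \<rightarrow>\<^sub>E {0..<int q}"

text \<open>
  A channel \<open>ch\<close> maps the modulus \<open>q\<close>, a receiver \<open>i\<close> and the symbols \<open>x j\<close> sent by the users \<open>j\<close>
  in one time slot to the symbol observed by receiver \<open>i\<close> in that slot.
\<close>

type_synonym channel = "nat \<Rightarrow> nat \<Rightarrow> (nat \<Rightarrow> int) \<Rightarrow> int"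

definition received :: "channel \<Rightarrow> nat \<Rightarrow> nat \<Rightarrow> nat \<Rightarrow> (nat \<Rightarrow> nat \<Rightarrow> int) \<Rightarrow> nat \<Rightarrow> int" where
  "received ch q l i X = (\<lambda>t\<in>{..<l}. ch q i (\<lambda>j. X j t))"

text \<open>
  Codebooks must be nonempty: otherwise the decoding condition would be vacuous for all users.
  Decoding is required to be free of errors.
\<close>

definition is_code :: "channel \<Rightarrow> nat \<Rightarrow> nat \<Rightarrow> nat \<Rightarrow> (nat \<Rightarrow> (nat \<Rightarrow> int) set) \<Rightarrow> bool" where
  "is_code ch K q l C \<longleftrightarrow>
     (\<forall>i\<in>{1..K}. C i \<noteq> {} \<and> C i \<subseteq> words q l) \<and>
     (\<forall>i\<in>{1..K}. \<exists>decode :: (nat \<Rightarrow> int) \<Rightarrow> (nat \<Rightarrow> int).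
        \<forall>X. (\<forall>j\<in>{1..K}. X j \<in> C j) \<longrightarrow> decode (received ch q l i X) = X i)"

definition achievable :: "channel \<Rightarrow> nat \<Rightarrow> nat \<Rightarrow> (nat \<Rightarrow> real) \<Rightarrow> bool" where
  "achievable ch K q R \<longleftrightarrow>
     (\<exists>l\<ge>1. \<exists>C. is_code ch K q l C \<and> (\<forall>i\<in>{1..K}. R i = ln (real (card (C i))) / real l))"

text \<open>
  Supremum and limit superior are taken in the extended reals, where they always exist. The
  base of the logarithm cancels in the quotient.
\<close>

definition sum_capacity :: "channel \<Rightarrow> nat \<Rightarrow> nat \<Rightarrow> ereal" where
  "sum_capacity ch K q = (SUP R\<in>{R. achievable ch K q R}. ereal (\<Sum>i=1..K. R i))"

definition DoF :: "channel \<Rightarrow> nat \<Rightarrow> ereal" where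
  "DoF ch K = Limsup (inf sequentially (principal {q. prime q}))
                (\<lambda>q. sum_capacity ch K q / ereal (ln (real q)))"

definition product_channel :: "nat \<Rightarrow> channel" where
  "product_channel K q i x = (x i * (\<Sum>j\<in>{1..K} - {i}. x j)) mod int q"

end

theory Submission
  imports Defs "HOL-Real_Asymp.Real_Asymp"
begin

text \<open>
  Upper bound: any two users together have rate at most \<open>ln q + ln 2\<close>. Fix the codewords of all
  other users. Where \<open>X\<^sub>i \<noteq> 0\<close>, receiver \<open>i\<close> learns \<open>X\<^sub>j\<close> from \<open>Y\<^sub>i\<close> after decoding \<open>X\<^sub>i\<close>; where
  \<open>X\<^sub>i = 0\<close>, the symbol \<open>Y\<^sub>i = 0\<close> carries no information. So the pair \<open>(X\<^sub>i, X\<^sub>j)\<close> is determined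
  by the support of \<open>X\<^sub>i\<close> and the word that agrees with \<open>Y\<^sub>i\<close> on this support and with \<open>X\<^sub>j\<close> off it,
  and the supports contribute only \<open>ln 2\<close> per slot. Averaging over all pairs gives \<open>K/2\<close>.

  Lower bound: over two slots user \<open>i\<close> sends \<open>u\<^sub>i\<close> and \<open>u\<^sub>i + 1\<close>. With \<open>S = \<Sum>\<^sub>j\<^sub>\<noteq>\<^sub>i u\<^sub>j\<close>,
  receiver \<open>i\<close> observes \<open>u\<^sub>i S\<close> and \<open>(u\<^sub>i + 1)(S + K - 1)\<close>, hence knows the product and the sum of
  \<open>(K - 1) u\<^sub>i\<close> and \<open>S\<close>, that is, the unordered pair of these two numbers. Choosing \<open>u\<^sub>i\<close> from
  \<open>[0, N)\<close> for \<open>i < K\<close> and \<open>u\<^sub>K\<close> from \<open>[K N, (K + 1) N)\<close>, with \<open>N\<close> about \<open>q / K\<^sup>2\<close>, makes the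
  order of the pair known.
\<close>

text \<open>Error-free decoding only asks that the observation determine the codeword: the decoder
  returns \<open>g\<close> at any admissible input that has this observation.\<close>

lemma ex_decoder_iff:
  "(\<exists>decode. \<forall>X. P X \<longrightarrow> decode (f X) = g X) \<longleftrightarrow> (\<forall>X Y. P X \<longrightarrow> P Y \<longrightarrow> f X = f Y \<longrightarrow> g X = g Y)"
proof
  assume R: "\<forall>X Y. P X \<longrightarrow> P Y \<longrightarrow> f X = f Y \<longrightarrow> g X = g Y"
  define d where "d y = g (SOME X. P X \<and> f X = y)" for y
  have "d (f X) = g X" if "P X" for X
  proof -
    have "P (SOME Z. P Z \<and> f Z = f X) \<and> f (SOME Z. P Z \<and> f Z = f X) = f X"
      by (rule someI[of _ X]) (simp add: that)
    then show ?thesis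
      using R that unfolding d_def by blast
  qed
  then show "\<exists>decode. \<forall>X. P X \<longrightarrow> decode (f X) = g X" by blast
qed metis

lemma finite_words: "finite (words q l)"
  unfolding words_def by (intro finite_PiE) auto

lemma card_words: "card (words q l) = q ^ l"
  unfolding words_def by (simp add: card_PiE)

lemma residue_eqI:
  fixes a b q :: int
  assumes "q dvd a - b" "0 \<le> a" "a < q" "0 \<le> b" "b < q"
  shows "a = b"
  using assms by (metis mod_eq_dvd_iff mod_pos_pos_trivial)

section \<open>Upper bound\<close>

text \<open>Sum the hypothesis over all \<open>n * (n - 1)\<close> ordered pairs of distinct
  elements, with \<open>n = card A\<close>: each \<open>f i\<close> is counted
  \<open>2 * (n - 1)\<close> times, and the positive factor \<open>n - 1\<close> cancels.\<close>

lemma sum_le_of_pairwise_le: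
  fixes f :: "'a \<Rightarrow> real"
  assumes fin: "finite A" and card: "card A \<ge> 2"
    and le: "\<And>i j. i \<in> A \<Longrightarrow> j \<in> A \<Longrightarrow> i \<noteq> j \<Longrightarrow> f i + f j \<le> c"
  shows "sum f A \<le> card A / 2 * c"
proof -
  let ?n = "real (card A)"
  have "(2 * ?n - 2) * sum f A = (\<Sum>i\<in>A. (?n - 2) * f i + sum f A)"
    by (simp add: sum.distrib sum_distrib_left[symmetric]) (simp add: algebra_simps)
  also have "\<dots> = (\<Sum>i\<in>A. \<Sum>j\<in>A - {i}. f i + f j)"
    using fin card
    by (intro sum.cong refl) (simp add: sum.distrib sum_diff1 of_nat_diff algebra_simps)
  also have "\<dots> \<le> (\<Sum>i\<in>A. \<Sum>j\<in>A - {i}. c)"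
    using le by (intro sum_mono) auto
  also have "\<dots> = ?n * (?n - 1) * c"
    using fin card by (simp add: of_nat_diff)
  finally have "(?n - 1) * sum f A \<le> (?n - 1) * (?n / 2 * c)"
    by (simp add: algebra_simps)
  then show ?thesis
    using card by (simp add: mult_le_cancel_left)
qed

lemma product_channel_code_pair:
  assumes code: "is_code (product_channel K) K q l C" and q: "prime q"
    and i: "i \<in> {1..K}" and j: "j \<in> {1..K}" and ij: "i \<noteq> j"
  shows "card (C i) * card (C j) \<le> 2 ^ l * q ^ l"
proof -
  have ne: "C k \<noteq> {}" and sub: "C k \<subseteq> words q l" if "k \<in> {1..K}" for k
    using code that unfolding is_code_def by auto
  \<comment> \<open>Only the decoder of receiver \<open>i\<close> is used; the word of user
    \<open>j\<close> is recovered from the channel equation.\<close>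
  obtain decode where decode:
    "\<And>X. \<forall>k\<in>{1..K}. X k \<in> C k \<Longrightarrow> decode (received (product_channel K) q l i X) = X i"
    using code i unfolding is_code_def by blast
  define z where "z k = (SOME w. w \<in> C k)" for k
  have z: "z k \<in> C k" if "k \<in> {1..K}" for k
    using ne[OF that] by (simp add: z_def some_in_eq)
  define X where "X a b = z(i := a, j := b)" for a b
  have X: "\<forall>k\<in>{1..K}. X a b k \<in> C k" if "a \<in> C i" "b \<in> C j" for a b
    using that z by (auto simp: X_def)
  define Y where "Y a b = received (product_channel K) q l i (X a b)" for a b
  define c where "c t = (\<Sum>k\<in>{1..K} - {i} - {j}. z k t)" for t
  have Y: "Y a b t = (a t * (b t + c t)) mod int q" if "t < l" for a b t
  proof -
    have "(\<Sum>k\<in>{1..K} - {i}. X a b k t) = X a b j t + (\<Sum>k\<in>{1..K} - {i} - {j}. X a b k t)"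
      using j ij by (intro sum.remove) auto
    also have "\<dots> = b t + c t"
      unfolding c_def X_def by (intro arg_cong2[of _ _ _ _ "(+)"] sum.cong) auto
    finally show ?thesis
      using that ij by (simp add: Y_def received_def product_channel_def X_def)
  qed
  have q0: "0 < int q" using q prime_gt_0_nat by simp
  have rng: "0 \<le> w t \<and> w t < int q" if "k \<in> {1..K}" "w \<in> C k" "t < l" for w k t
    using sub[of k] that by (auto simp: words_def PiE_iff)
  define \<Phi> where "\<Phi> = (\<lambda>(a, b). ({t \<in> {..<l}. a t \<noteq> 0},
     \<lambda>t\<in>{..<l}. if a t = 0 then b t else Y a b t))"
  have "inj_on \<Phi> (C i \<times> C j)"
  proof (rule inj_onI, clarify)
    fix a b a' b'
    assume a: "a \<in> C i" and b: "b \<in> C j" and a': "a' \<in> C i" and b': "b' \<in> C j"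
      and eq: "\<Phi> (a, b) = \<Phi> (a', b')"
    have supp: "a t = 0 \<longleftrightarrow> a' t = 0" if "t < l" for t
      using eq that unfolding \<Phi>_def by auto
    have val: "(if a t = 0 then b t else Y a b t) = (if a' t = 0 then b' t else Y a' b' t)"
      if "t < l" for t
    proof -
      have "(\<lambda>t\<in>{..<l}. if a t = 0 then b t else Y a b t) t =
        (\<lambda>t\<in>{..<l}. if a' t = 0 then b' t else Y a' b' t) t"
        using eq unfolding \<Phi>_def by simp
      then show ?thesis using that by simp
    qed
    \<comment> \<open>Where \<open>a\<close> vanishes, the second component of \<open>\<Phi>\<close>
      does not record \<open>Y\<close>, but there \<open>Y\<close> is 0 for both pairs. So the whole
      observation is recovered and can be decoded.\<close>
    have Yt: "Y a b t = Y a' b' t" if "t < l" for t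
      using supp[OF that] val[OF that] by (cases "a t = 0") (simp_all add: Y that)
    have "Y a b = Y a' b'"
    proof (rule extensionalityI[of _ "{..<l}"])
      show "Y a b \<in> extensional {..<l}" "Y a' b' \<in> extensional {..<l}"
        by (simp_all add: Y_def received_def)
    qed (use Yt in simp)
    then have "X a b i = X a' b' i"
      using decode[OF X[OF a b]] decode[OF X[OF a' b']] unfolding Y_def by metis
    then have aa: "a = a'" using ij by (simp add: X_def)
    have "b t = b' t" if t: "t < l" for t
    proof (cases "a t = 0")
      case True
      then show ?thesis using val[OF t] aa by simp
    next
      case False
      have "int q dvd a t * (b t + c t) - a t * (b' t + c t)"
        using Yt[OF t] aa by (simp add: Y t mod_eq_dvd_iff)
      then have "int q dvd a t * (b t - b' t)" by (simp add: algebra_simps)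
      moreover have "\<not> int q dvd a t"
        using rng[OF i a t] False by (simp add: zdvd_not_zless)
      ultimately have "int q dvd b t - b' t"
        using q by (simp add: prime_dvd_mult_iff)
      then show ?thesis using rng[OF j b t] rng[OF j b' t] by (intro residue_eqI) auto
    qed
    then have "b = b'"
      using b b' sub[OF j] unfolding words_def by (intro PiE_ext[of b "{..<l}"]) auto
    with aa show "a = a' \<and> b = b'" by simp
  qed
  moreover have "\<Phi> ` (C i \<times> C j) \<subseteq> Pow {..<l} \<times> words q l"
  proof (clarify)
    fix a b S w assume ab: "a \<in> C i" "b \<in> C j" and "(S, w) = \<Phi> (a, b)"
    then have S: "S = {t \<in> {..<l}. a t \<noteq> 0}"
      and w: "w = (\<lambda>t\<in>{..<l}. if a t = 0 then b t else Y a b t)"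
      by (auto simp: \<Phi>_def)
    show "S \<in> Pow {..<l} \<and> w \<in> words q l"
      using rng[OF j ab(2)] q0 by (auto simp: S w words_def Y)
  qed
  ultimately have "card (C i \<times> C j) \<le> card (Pow {..<l} \<times> words q l)"
    by (intro card_inj_on_le) (auto simp: finite_words)
  then show ?thesis by (simp add: card_cartesian_product card_Pow card_words)
qed

lemma product_channel_sum_capacity_le:
  assumes K: "K \<ge> 2" and q: "prime q"
  shows "sum_capacity (product_channel K) K q \<le> ereal (real K / 2 * (ln (real q) + ln 2))"
  unfolding sum_capacity_def
proof (rule SUP_least, clarify)
  fix R assume "achievable (product_channel K) K q R"
  then obtain l C where l: "l \<ge> 1" and code: "is_code (product_channel K) K q l C"
    and R: "\<And>i. i \<in> {1..K} \<Longrightarrow> R i = ln (real (card (C i))) / real l"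
    unfolding achievable_def by auto
  have q0: "0 < q" using q prime_gt_0_nat by blast
  have card_pos: "0 < card (C i)" if "i \<in> {1..K}" for i
  proof -
    have "C i \<noteq> {}" "C i \<subseteq> words q l" using code that unfolding is_code_def by auto
    then show ?thesis by (metis card_gt_0_iff finite_subset finite_words)
  qed
  have "R i + R j \<le> ln (real q) + ln 2" if ij: "i \<in> {1..K}" "j \<in> {1..K}" "i \<noteq> j" for i j
  proof -
    have "real (card (C i)) * real (card (C j)) \<le> 2 ^ l * real q ^ l"
      using of_nat_mono[OF product_channel_code_pair[OF code q ij], where ?'a = real] by simp
    then have "ln (real (card (C i)) * real (card (C j))) \<le> ln (2 ^ l * real q ^ l)"
      using card_pos ij q0 by (intro ln_mono) auto
    then have "ln (real (card (C i))) + ln (real (card (C j))) \<le> real l * (ln (real q) + ln 2)"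
      using card_pos[OF ij(1)] card_pos[OF ij(2)] q0
      by (simp add: ln_mult ln_realpow algebra_simps)
    then show ?thesis
      using l ij by (simp add: R add_divide_distrib[symmetric] divide_le_eq algebra_simps)
  qed
  then have "sum R {1..K} \<le> card {1..K} / 2 * (ln (real q) + ln 2)"
    using K by (intro sum_le_of_pairwise_le) auto
  then show "ereal (\<Sum>i = 1..K. R i) \<le> ereal (real K / 2 * (ln (real q) + ln 2))" by simp
qed

section \<open>Lower bound\<close>

text \<open>Modulo \<open>q\<close>, the polynomials (T - p)(T - s) and (T - p')(T - s') have the
  same coefficients, so \<open>p\<close> is a root of the second; modulo a prime there are no zero
  divisors.\<close>

lemma unordered_pair_mod:
  fixes q p s p' s' :: int
  assumes q: "prime q" and prod: "q dvd p * s - p' * s'" and sum: "q dvd (p + s) - (p' + s')"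
  shows "q dvd p - p' \<or> q dvd p - s'"
proof -
  have "(p - p') * (p - s') = p * ((p + s) - (p' + s')) - (p * s - p' * s')"
    by (simp add: algebra_simps)
  then have "q dvd (p - p') * (p - s')"
    using prod sum by (metis dvd_diff dvd_mult)
  then show ?thesis using q by (simp add: prime_dvd_mult_iff)
qed

text \<open>The symbols are plain integers without reduction, so sums and order can be compared in
  the integers; they are residues once \<open>K\<^sup>2 * N \<le> q\<close>.\<close>

definition shift_code :: "nat \<Rightarrow> nat \<Rightarrow> nat \<Rightarrow> (nat \<Rightarrow> int) set" where
  "shift_code K N i =
     (\<lambda>n. \<lambda>t\<in>{..<2}. int ((if i = K then K * N else 0) + n + t)) ` {..<N}"

lemma card_shift_code: "card (shift_code K N i) = N"
proof -
  have "inj_on (\<lambda>n. \<lambda>t\<in>{..<2}. int ((if i = K then K * N else 0) + n + t)) {..<N}"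
    by (rule inj_onI, drule fun_cong[of _ _ 0]) simp
  then show ?thesis by (simp add: shift_code_def card_image)
qed

lemma shift_code_memD:
  assumes "x \<in> shift_code K N i"
  shows "x \<in> extensional {..<2}" "x (Suc 0) = x 0 + 1" "0 \<le> x 0"
    "i \<noteq> K \<Longrightarrow> x 0 < int N" "i = K \<Longrightarrow> int K * int N \<le> x 0" "i = K \<Longrightarrow> x 0 < (int K + 1) * int N"
  using assms by (auto simp: shift_code_def algebra_simps)

text \<open>The word \<open>x\<close> need not be \<open>X i\<close>: decoding compares the signal
  of one transmission with the interference of another. For \<open>i = K\<close>, s \<le> (K-1)N <
  (K-1)KN \<le> (K-1) \<open>x 0\<close>. Otherwise the offset of user \<open>K\<close> enters the
  interference, and (K-1) \<open>x 0\<close> \<le> (K-1)N < KN \<le> s.\<close>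

lemma shift_code_interference:
  assumes i: "i \<in> {1..K}" and K: "K \<ge> 2" and N: "N \<ge> 1"
    and X: "\<forall>k\<in>{1..K}. X k \<in> shift_code K N k" and x: "x \<in> shift_code K N i"
  defines "s \<equiv> (\<Sum>k\<in>{1..K} - {i}. X k 0)"
  shows "0 \<le> s" "s < (int K)\<^sup>2 * int N" "(int K - 1) * x 0 < (int K)\<^sup>2 * int N" "(int K - 1) * x 0 \<noteq> s"
proof -
  have nn: "0 \<le> X k 0" if "k \<in> {1..K}" for k
    using X that shift_code_memD by blast
  then show "0 \<le> s" unfolding s_def by (intro sum_nonneg) auto
  have NN: "0 < int N" using N by simp
  have K2: "2 * int K \<le> int K ^ 2" using K by (simp add: power2_eq_square)
  have "s < (int K)\<^sup>2 * int N \<and> (int K - 1) * x 0 < (int K)\<^sup>2 * int N \<and> (int K - 1) * x 0 \<noteq> s"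
  proof (cases "i = K")
    case True
    have "s \<le> (\<Sum>k\<in>{1..K} - {i}. int N)"
      unfolding s_def using X True by (intro sum_mono) (force dest: shift_code_memD(4))
    also have "\<dots> = (int K - 1) * int N"
      using i by (simp add: of_nat_diff)
    finally have s: "s \<le> (int K - 1) * int N" .
    have lo: "(int K - 1) * (int K * int N) \<le> (int K - 1) * x 0"
      using shift_code_memD(5)[OF x True] K by (intro mult_left_mono) auto
    have hi: "(int K - 1) * x 0 < (int K - 1) * ((int K + 1) * int N)"
      using shift_code_memD(6)[OF x True] K by (intro mult_strict_left_mono) auto
    have "(int K - 1) * int N < (int K - 1) * (int K * int N)"
      using K NN by (intro mult_strict_left_mono) auto
    \<comment> \<open>The scaled signal of user \<open>K\<close> is the largest quantity; it gives
      rise to the bound \<open>K\<^sup>2 * N\<close>.\<close>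
    moreover have "(int K - 1) * ((int K + 1) * int N) = (int K)\<^sup>2 * int N - int N"
      by (simp add: algebra_simps power2_eq_square)
    ultimately show ?thesis using s lo hi NN by linarith
  next
    case False
    then have KA: "K \<in> {1..K} - {i}" using K by auto
    have s: "s = X K 0 + (\<Sum>k\<in>{1..K} - {i} - {K}. X k 0)"
      unfolding s_def using KA by (intro sum.remove) auto
    have XK: "int K * int N \<le> X K 0" "X K 0 < (int K + 1) * int N"
      using X K shift_code_memD(5,6)[of "X K" K N K] by auto
    have "0 \<le> (\<Sum>k\<in>{1..K} - {i} - {K}. X k 0)"
      by (intro sum_nonneg) (use nn in auto)
    then have lo: "int K * int N \<le> s" using s XK by linarith
    have "(\<Sum>k\<in>{1..K} - {i} - {K}. X k 0) \<le> (\<Sum>k\<in>{1..K} - {i} - {K}. int N)"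
      using X by (intro sum_mono) (force dest: shift_code_memD(4))
    also have "\<dots> = (int K - 2) * int N"
      using i KA K by (simp add: of_nat_diff)
    finally have "s < (int K + 1) * int N + (int K - 2) * int N" using s XK by linarith
    also have "\<dots> \<le> 2 * int K * int N" using NN by (simp add: algebra_simps)
    also have "\<dots> \<le> (int K)\<^sup>2 * int N" using K2 by (intro mult_right_mono) auto
    finally have hi: "s < (int K)\<^sup>2 * int N" .
    have "(int K - 1) * x 0 \<le> (int K - 1) * int N"
      using shift_code_memD(4)[OF x False] K by (intro mult_left_mono) auto
    also have "\<dots> < int K * int N" using NN by (simp add: algebra_simps)
    finally show ?thesis using lo hi by linarith
  qed
  then show "s < (int K)\<^sup>2 * int N" "(int K - 1) * x 0 < (int K)\<^sup>2 * int N" "(int K - 1) * x 0 \<noteq> s"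
    by auto
qed

lemma shift_code_subset_words:
  assumes K: "K \<ge> 2" and N: "N \<ge> 1" "K\<^sup>2 * N \<le> q"
  shows "shift_code K N i \<subseteq> words q 2"
proof
  fix x assume "x \<in> shift_code K N i"
  then obtain n where n: "n < N"
    and x: "x = (\<lambda>t\<in>{..<2}. int ((if i = K then K * N else 0) + n + t))"
    by (auto simp: shift_code_def)
  \<comment> \<open>The largest symbol, \<open>K * N + n + 1\<close>, is at most
    \<open>(K + 1) * N\<close>, hence strictly below \<open>(K + 2) * N\<close>.\<close>
  have "(K + 2) * N \<le> K\<^sup>2 * N"
  proof (intro mult_right_mono)
    have "2 * K \<le> K * K" using K by (intro mult_right_mono) auto
    then show "K + 2 \<le> K\<^sup>2" using K unfolding power2_eq_square by linarith
  qed simp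
  then have nat: "K * N + n + 1 < q" using n N by (simp add: algebra_simps)
  then have "int K * int N + int n + 1 < int q"
    using of_nat_less_iff[of "K * N + n + 1" q, where ?'a = int] by simp
  with nat show "x \<in> words q 2"
    unfolding x words_def by (auto simp: less_2_cases_iff)
qed

lemma is_code_shift_code:
  assumes K: "K \<ge> 2" and N: "N \<ge> 1" "K\<^sup>2 * N \<le> q" and q: "prime q"
  shows "is_code (product_channel K) K q 2 (shift_code K N)"
  unfolding is_code_def ex_decoder_iff
proof (intro conjI ballI allI impI)
  fix i assume "i \<in> {1..K}"
  show "shift_code K N i \<noteq> {}"
    using N by (auto simp: shift_code_def lessThan_empty_iff)
  show "shift_code K N i \<subseteq> words q 2"
    by (rule shift_code_subset_words[OF K N])
next
  fix i X Y
  assume i: "i \<in> {1..K}" and X: "\<forall>j\<in>{1..K}. X j \<in> shift_code K N j"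
    and Y: "\<forall>j\<in>{1..K}. Y j \<in> shift_code K N j"
    and eq: "received (product_channel K) q 2 i X = received (product_channel K) q 2 i Y"
  \<comment> \<open>The growth of the interference from slot 0 to slot 1: each of the K - 1
    interferers adds 1.\<close>
  define m where "m = int K - 1"
  define sX where "sX = (\<Sum>k\<in>{1..K} - {i}. X k 0)"
  define sY where "sY = (\<Sum>k\<in>{1..K} - {i}. Y k 0)"
  have sum1: "(\<Sum>k\<in>{1..K} - {i}. Z k (Suc 0)) = (\<Sum>k\<in>{1..K} - {i}. Z k 0) + m"
    if "\<forall>j\<in>{1..K}. Z j \<in> shift_code K N j" for Z
  proof -
    have "(\<Sum>k\<in>{1..K} - {i}. Z k (Suc 0)) = (\<Sum>k\<in>{1..K} - {i}. Z k 0 + 1)"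
      using that by (intro sum.cong refl) (auto dest: shift_code_memD(2))
    then show ?thesis using i by (simp add: sum.distrib m_def of_nat_diff)
  qed
  have Xi: "X i \<in> shift_code K N i" and Yi: "Y i \<in> shift_code K N i"
    using X Y i by auto
  have Yt: "(X i t * (\<Sum>k\<in>{1..K} - {i}. X k t)) mod int q =
      (Y i t * (\<Sum>k\<in>{1..K} - {i}. Y k t)) mod int q" if "t < 2" for t
    using fun_cong[OF eq, of t] that by (simp add: received_def product_channel_def)
  have slot0: "int q dvd X i 0 * sX - Y i 0 * sY"
    using Yt[of 0] unfolding sX_def sY_def mod_eq_dvd_iff by simp
  have slot1: "int q dvd (X i 0 + 1) * (sX + m) - (Y i 0 + 1) * (sY + m)"
    using Yt[of "Suc 0"]
    unfolding sX_def sY_def mod_eq_dvd_iff sum1[OF X] sum1[OF Y]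
      shift_code_memD(2)[OF Xi] shift_code_memD(2)[OF Yi] by simp
  have "int q dvd m * X i 0 * sX - m * Y i 0 * sY"
    using dvd_mult[OF slot0, of m] by (simp add: algebra_simps)
  \<comment> \<open>Since (x + 1)(s + m) - x s = m x + s + m, the difference of the slots reveals
    the sum of \<open>m * x\<close> and \<open>s\<close>.\<close>
  moreover have "int q dvd (m * X i 0 + sX) - (m * Y i 0 + sY)"
    using dvd_diff[OF slot1 slot0] by (simp add: algebra_simps)
  ultimately have "int q dvd m * X i 0 - m * Y i 0 \<or> int q dvd m * X i 0 - sY"
    using q by (intro unordered_pair_mod) auto
  moreover have "(int K)\<^sup>2 * int N \<le> int q"
    using of_nat_mono[OF N(2), where ?'a = int] by simp
  \<comment> \<open>All quantities lie in [0, q), so congruence means equality, and the swapped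
    alternative \<open>m * X i 0 = sY\<close> is excluded.\<close>
  then have "m * X i 0 < int q" "m * Y i 0 < int q" "sY < int q" "0 \<le> sY" "m * X i 0 \<noteq> sY"
    using shift_code_interference[OF i K N(1) Y Xi] shift_code_interference[OF i K N(1) Y Yi]
    by (auto simp: m_def sY_def)
  moreover have "0 \<le> m * X i 0" "0 \<le> m * Y i 0"
    using shift_code_memD(3)[OF Xi] shift_code_memD(3)[OF Yi] K by (simp_all add: m_def)
  ultimately have "m * X i 0 = m * Y i 0"
    using residue_eqI by blast
  then have eq0: "X i 0 = Y i 0" using K by (simp add: m_def)
  show "X i = Y i"
  proof (rule extensionalityI[of _ "{..<2}"])
    fix t :: nat assume "t \<in> {..<2}"
    then show "X i t = Y i t"
      using eq0 shift_code_memD(2)[OF Xi] shift_code_memD(2)[OF Yi] by (auto simp: less_2_cases_iff)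
  qed (use shift_code_memD(1) Xi Yi in auto)
qed

lemma product_channel_sum_capacity_ge:
  assumes K: "K \<ge> 2" and q: "prime q" and qK: "2 * K\<^sup>2 \<le> q"
  shows "ereal (real K / 2 * (ln (real q) - ln (2 * real K ^ 2)))
     \<le> sum_capacity (product_channel K) K q"
proof -
  \<comment> \<open>The largest size for which the code fits. Since N \<ge> 1, q < K^2 N + K^2 \<le>
    2 K^2 N, so \<open>ln N\<close> differs from \<open>ln q\<close> by at most the constant
    \<open>ln (2 * K^2)\<close>.\<close>
  define N where "N = q div K\<^sup>2"
  have K0: "0 < K\<^sup>2" using K by simp
  have KN: "K\<^sup>2 * N \<le> q" "q < K\<^sup>2 * N + K\<^sup>2"
    using K0 mult_div_mod_eq[of "K\<^sup>2" q] mod_less_divisor[OF K0, of q]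
    unfolding N_def by linarith+
  have N: "1 \<le> N"
    using qK K0 unfolding N_def by (simp add: Suc_le_eq div_greater_zero_iff)
  have "K\<^sup>2 * 1 \<le> K\<^sup>2 * N" using N by (rule mult_left_mono) simp
  then have "q \<le> (2 * K\<^sup>2) * N" using KN by linarith
  then have "real q \<le> (2 * real K ^ 2) * real N"
    using of_nat_mono[where ?'a = real, of q "(2 * K\<^sup>2) * N"] by simp
  moreover have "0 < q" using q prime_gt_0_nat by blast
  ultimately have "ln (real q) \<le> ln ((2 * real K ^ 2) * real N)"
    by (intro ln_mono) auto
  also have "\<dots> = ln (2 * real K ^ 2) + ln (real N)"
    using K N by (intro ln_mult_pos) auto
  finally have "real K / 2 * (ln (real q) - ln (2 * real K ^ 2)) \<le> real K / 2 * ln (real N)"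
    by (intro mult_left_mono) auto
  also have "\<dots> = (\<Sum>i=1..K. ln (real N) / 2)" by simp
  finally have "ereal (real K / 2 * (ln (real q) - ln (2 * real K ^ 2)))
      \<le> ereal (\<Sum>i=1..K. ln (real N) / 2)" by simp
  also have "\<dots> \<le> sum_capacity (product_channel K) K q"
    unfolding sum_capacity_def
  proof (rule SUP_upper, clarify)
    show "achievable (product_channel K) K q (\<lambda>_. ln (real N) / 2)"
      unfolding achievable_def using is_code_shift_code[OF K N KN(1) q]
      by (intro exI[of _ 2] conjI exI[of _ "shift_code K N"]) (auto simp: card_shift_code)
  qed
  finally show ?thesis .
qed

section \<open>Limit along the primes\<close>

theorem theorem4:
  fixes K :: nat
  assumes "K \<ge> 2"
  shows "DoF (product_channel K) K = ereal (real K / 2)"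
proof -
  define F where "F = inf sequentially (principal {q::nat. prime q})"
  define f where "f q = sum_capacity (product_channel K) K q / ereal (ln (real q))" for q
  have F_le: "F \<le> sequentially" unfolding F_def by simp
  \<comment> \<open>There are infinitely many primes; this lets convergence along \<open>F\<close>
    determine the limit superior.\<close>
  have F_nontrivial: "F \<noteq> bot"
  proof
    assume "F = bot"
    then have "eventually (\<lambda>q::nat. \<not> prime q) sequentially"
      unfolding F_def trivial_limit_def eventually_inf_principal by simp
    then obtain n where "\<And>q. q \<ge> n \<Longrightarrow> \<not> prime (q::nat)"
      unfolding eventually_sequentially by blast
    then show False using bigger_prime[of n] by (meson less_imp_le)
  qed
  define lo where "lo q = real K / 2 * (ln (real q) - ln (2 * real K ^ 2)) / ln (real q)" for q :: nat
  define hi where "hi q = real K / 2 * (ln (real q) + ln 2) / ln (real q)" for q :: nat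
  \<comment> \<open>The additive constants in both bounds vanish after division by
    \<open>ln q\<close>.\<close>
  have "lo \<longlonglongrightarrow> real K / 2" "hi \<longlonglongrightarrow> real K / 2"
    unfolding lo_def hi_def by real_asymp+
  then have lim: "((\<lambda>q. ereal (lo q)) \<longlongrightarrow> ereal (real K / 2)) F"
    "((\<lambda>q. ereal (hi q)) \<longlongrightarrow> ereal (real K / 2)) F"
    using F_le by (auto intro: tendsto_mono)
  have large: "eventually (\<lambda>q. prime q \<and> 2 * K\<^sup>2 \<le> q) F"
    unfolding F_def eventually_inf_principal
    by (rule eventually_mono[OF eventually_ge_at_top[of "2 * K\<^sup>2"]]) simp
  have bounds: "ereal (lo q) \<le> f q \<and> f q \<le> ereal (hi q)" if "prime q \<and> 2 * K\<^sup>2 \<le> q" for q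
  proof -
    have q1: "q > 1" using that prime_gt_1_nat by blast
    then have ln: "0 < ereal (ln (real q))" by simp
    have "ereal (lo q) = ereal (real K / 2 * (ln (real q) - ln (2 * real K ^ 2))) / ereal (ln (real q))"
      "ereal (hi q) = ereal (real K / 2 * (ln (real q) + ln 2)) / ereal (ln (real q))"
      using q1 by (simp_all add: lo_def hi_def)
    moreover have "sum_capacity (product_channel K) K q \<le> ereal (real K / 2 * (ln (real q) + ln 2))"
      "ereal (real K / 2 * (ln (real q) - ln (2 * real K ^ 2))) \<le> sum_capacity (product_channel K) K q"
      using that assms product_channel_sum_capacity_le product_channel_sum_capacity_ge by blast+
    ultimately show ?thesis
      unfolding f_def using ln by (simp only: ereal_divide_right_mono)
  qed
  have "(f \<longlongrightarrow> ereal (real K / 2)) F"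
    by (rule tendsto_sandwich[OF _ _ lim]) (use large bounds in \<open>auto elim: eventually_mono\<close>)
  then have "Limsup F f = ereal (real K / 2)"
    by (rule lim_imp_Limsup[OF F_nontrivial])
  then show ?thesis unfolding DoF_def F_def f_def .
qed

end
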